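(* The inequality of the values of $\sigma(x)/x$ for any pair of different coprime natural numbers is a necessary condition for the non-existence of an odd multiply perfect number. That is: if there is no odd multiply perfect number, then $\dfrac{\sigma(x)}{x}\ne\dfrac{\sigma(y)}{y}$ for all coprime $x,y\in\mathbb{N}$ with $x\ne y$.
   Context: $\mathbb{N}$ is the set of positive integers and $\sigma(x)=\sum_{d\mid x}d$ is the sum of the positive divisors of $x$. A number $m\in\mathbb{N}$ is multiply perfect if $\sigma(m)=k\cdot m$ for some integer $k\ge2$. *)

theory Defs
  imports Complex_Main
begin

text \<open>
  All notions concern positive integers. Every number divides \<open>0\<close>, so \<open>divisor_sigma 0 = 0\<close> is a
  meaningless value (sum over an infinite set); positivity is therefore required explicitly below.
\<close>

definition divisor_sigma :: "nat \<Rightarrow> nat" where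
  "divisor_sigma n = (\<Sum>d | d dvd n. d)"

definition multiply_perfect :: "nat \<Rightarrow> bool" where
  "multiply_perfect m \<longleftrightarrow> m > 0 \<and> (\<exists>k::int. k \<ge> 2 \<and> int (divisor_sigma m) = k * int m)"

end

theory Submission
  imports Defs
begin

text \<open>By contraposition: distinct coprime x, y with the same ratio \<sigma>(x)/x =
  \<sigma>(y)/y yield an odd multiply perfect number. Coprimality forces the common ratio to be an
  integer k (\<open>coprime_sigma_ratio_eq\<close>). Since \<sigma>(n) > n for n > 1
  (\<open>divisor_sigma_gt\<close>), k = 1 would mean x = y = 1; so k \<ge> 2 and both numbers are
  multiply perfect (\<open>multiply_perfectI\<close>). Being coprime, they are not both
  even.\<close>

lemma divisor_sigma_1: "divisor_sigma 1 = 1"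
  by (simp add: divisor_sigma_def)

text \<open>The two distinct divisors 1 and n already contribute n + 1.\<close>

lemma divisor_sigma_gt:
  assumes "n > 1"
  shows "divisor_sigma n > n"
proof -
  have "n < (\<Sum>d\<in>{1, n}. d)"
    using assms by simp
  also have "\<dots> \<le> (\<Sum>d | d dvd n. d)"
    using assms by (intro sum_mono2) auto
  finally show ?thesis
    by (simp add: divisor_sigma_def)
qed

lemma multiply_perfectI:
  assumes "n > 1" "divisor_sigma n = k * n"
  shows "multiply_perfect n"
proof -
  have "1 * n < k * n"
    using divisor_sigma_gt[OF assms(1)] assms(2) by simp
  then have "int k \<ge> 2"
    by simp
  moreover have "int (divisor_sigma n) = int k * int n"
    using assms(2) by simp
  ultimately show ?thesis
    using assms(1) unfolding multiply_perfect_def by auto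
qed

text \<open>In lowest terms the common ratio has a denominator dividing both x and y, hence equal to
  1. The proof cross-multiplies instead, to argue by divisibility in the naturals.\<close>

lemma coprime_sigma_ratio_eq:
  assumes "x > 0" "y > 0" "coprime x y"
    and "real (divisor_sigma x) / real x = real (divisor_sigma y) / real y"
  obtains k where "divisor_sigma x = k * x" "divisor_sigma y = k * y"
proof -
  have "real (divisor_sigma x * y) = real (divisor_sigma y * x)"
    using assms(1,2,4) by (simp add: field_simps)
  then have eq: "divisor_sigma x * y = divisor_sigma y * x"
    by (simp only: of_nat_eq_iff)
  then have "x dvd divisor_sigma x * y"
    by simp
  with assms(3) have "x dvd divisor_sigma x"
    by (simp add: coprime_dvd_mult_left_iff)
  then obtain k where k: "divisor_sigma x = k * x"
    by (metis dvd_def mult.commute)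
  with eq assms(1) have "divisor_sigma y = k * y"
    by simp
  with k show ?thesis
    by (rule that)
qed

theorem corollary6p4:
  assumes "\<not> (\<exists>m. odd m \<and> multiply_perfect m)"
  shows "\<forall>x y :: nat. x > 0 \<longrightarrow> y > 0 \<longrightarrow> coprime x y \<longrightarrow> x \<noteq> y \<longrightarrow>
           real (divisor_sigma x) / real x \<noteq> real (divisor_sigma y) / real y"
proof (intro allI impI notI)
  fix x y :: nat
  assume pos: "x > 0" "y > 0" and "coprime x y" and "x \<noteq> y"
    and "real (divisor_sigma x) / real x = real (divisor_sigma y) / real y"
  then obtain k where k: "divisor_sigma x = k * x" "divisor_sigma y = k * y"
    using coprime_sigma_ratio_eq by blast
  \<comment> \<open>The number 1 has ratio 1 without being multiply perfect, so it must be excluded.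
    If one of the two were 1, then k = 1, and \<open>divisor_sigma_gt\<close> would make the other 1
    as well; this is where x \<noteq> y enters.\<close>
  have "x > 1 \<and> y > 1"
  proof (rule ccontr)
    assume "\<not> (x > 1 \<and> y > 1)"
    with pos have "x = 1 \<or> y = 1"
      by linarith
    with k have "k = 1"
      using divisor_sigma_1 by auto
    with k have "\<not> x > 1" "\<not> y > 1"
      using divisor_sigma_gt[of x] divisor_sigma_gt[of y] by auto
    with pos have "x = 1" "y = 1"
      by linarith+
    with \<open>x \<noteq> y\<close> show False
      by simp
  qed
  with k have "multiply_perfect x" "multiply_perfect y"
    using multiply_perfectI by blast+
  moreover have "odd x \<or> odd y"
    using \<open>coprime x y\<close> coprime_common_divisor by fastforce
  ultimately show False
    using assms by blast
qed

end
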